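(* For every integer $n\ge 6$, $K_n=2^{\aleph_0}$; that is, the set of isomorphism classes of lattices $\mathscr{K}(X)$, where $X$ ranges over the $n$-point subsets of $\mathbb{R}^2$, has the cardinality of the continuum.
   Context: The family $\mathscr{K}$ of all convex subsets of $\mathbb{R}^2$ is a lattice with operations $A\vee B=\mathrm{ch}(A\cup B)$ (convex hull of the union) and $A\wedge B=A\cap B$. For $X\subseteq\mathbb{R}^2$, $\mathscr{K}(X)$ is the smallest sublattice of $\mathscr{K}$ containing all the singletons $\{x\}$, $x\in X$. $K_n$ denotes the number (cardinality) of lattices $\mathscr{K}(X)$ with $X\subseteq\mathbb{R}^2$, $|X|=n$, counted up to lattice isomorphism. *)

theory Defs
  imports "HOL-Analysis.Analysis" "HOL-Library.Equipollence"
begin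

definition convex_sets :: "(real^2) set set" where
  "convex_sets = {A. convex A}"

text \<open>The empty set is convex, so it is the least element of this lattice.\<close>

definition cjoin :: "(real^2) set \<Rightarrow> (real^2) set \<Rightarrow> (real^2) set" where
  "cjoin A B = convex hull (A \<union> B)"

definition cmeet :: "(real^2) set \<Rightarrow> (real^2) set \<Rightarrow> (real^2) set" where
  "cmeet A B = A \<inter> B"

definition convex_sublattice :: "(real^2) set set \<Rightarrow> bool" where
  "convex_sublattice L \<longleftrightarrow>
     L \<subseteq> convex_sets \<and> (\<forall>A\<in>L. \<forall>B\<in>L. cjoin A B \<in> L \<and> cmeet A B \<in> L)"

definition gen_lattice :: "(real^2) set \<Rightarrow> (real^2) set set" where
  "gen_lattice X = \<Inter>{L. convex_sublattice L \<and> (\<forall>x\<in>X. {x} \<in> L)}"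

definition lattice_iso :: "(real^2) set set \<Rightarrow> (real^2) set set \<Rightarrow> bool" where
  "lattice_iso L M \<longleftrightarrow>
     (\<exists>f. bij_betw f L M \<and>
       (\<forall>A\<in>L. \<forall>B\<in>L. f (cjoin A B) = cjoin (f A) (f B) \<and> f (cmeet A B) = cmeet (f A) (f B)))"

definition gen_lattices :: "nat \<Rightarrow> (real^2) set set set" where
  "gen_lattices n = {gen_lattice X |X. finite X \<and> card X = n}"

definition iso_rel :: "nat \<Rightarrow> ((real^2) set set \<times> (real^2) set set) set" where
  "iso_rel n = {(L, M). L \<in> gen_lattices n \<and> M \<in> gen_lattices n \<and> lattice_iso L M}"

lemma convex_sublattice_convex_sets: "convex_sublattice convex_sets"
  by (auto simp: convex_sublattice_def convex_sets_def cjoin_def cmeet_def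
      convex_Int convex_convex_hull)

lemma singleton_in_gen_lattice: "x \<in> X \<Longrightarrow> {x} \<in> gen_lattice X"
  by (auto simp: gen_lattice_def)

lemma gen_lattice_least:
  "convex_sublattice L \<Longrightarrow> (\<And>x. x \<in> X \<Longrightarrow> {x} \<in> L) \<Longrightarrow> gen_lattice X \<subseteq> L"
  by (auto simp: gen_lattice_def)

lemma convex_sublattice_gen_lattice: "convex_sublattice (gen_lattice X)"
proof -
  have "gen_lattice X \<subseteq> convex_sets"
    by (rule gen_lattice_least[OF convex_sublattice_convex_sets]) (simp add: convex_sets_def)
  then show ?thesis
    unfolding convex_sublattice_def by (auto simp: gen_lattice_def convex_sublattice_def)
qed

lemma lattice_iso_refl: "lattice_iso L L"
  unfolding lattice_iso_def by (rule exI[of _ id]) auto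

lemma lattice_iso_sym:
  assumes "convex_sublattice L" "lattice_iso L M"
  shows "lattice_iso M L"
proof -
  obtain f where f: "bij_betw f L M"
    and hom: "\<And>A B. A \<in> L \<Longrightarrow> B \<in> L \<Longrightarrow>
      f (cjoin A B) = cjoin (f A) (f B) \<and> f (cmeet A B) = cmeet (f A) (f B)"
    using assms(2) unfolding lattice_iso_def by blast
  let ?g = "inv_into L f"
  have g: "bij_betw ?g M L"
    by (rule bij_betw_inv_into[OF f])
  have "?g (cjoin A B) = cjoin (?g A) (?g B) \<and> ?g (cmeet A B) = cmeet (?g A) (?g B)"
    if "A \<in> M" "B \<in> M" for A B
  proof -
    have in_L: "?g A \<in> L" "?g B \<in> L"
      using g that by (auto simp: bij_betw_def)
    have eqs: "f (?g A) = A" "f (?g B) = B"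
      using f that by (simp_all add: bij_betw_inv_into_right)
    have closed: "cjoin (?g A) (?g B) \<in> L" "cmeet (?g A) (?g B) \<in> L"
      using assms(1) in_L by (auto simp: convex_sublattice_def)
    show ?thesis
      using hom[OF in_L] bij_betw_inv_into_left[OF f closed(1)]
        bij_betw_inv_into_left[OF f closed(2)] eqs by simp
  qed
  then show ?thesis
    unfolding lattice_iso_def using g by blast
qed

lemma lattice_iso_trans:
  assumes "lattice_iso L M" "lattice_iso M N"
  shows "lattice_iso L N"
proof -
  obtain f where f: "bij_betw f L M" "\<And>A B. A \<in> L \<Longrightarrow> B \<in> L \<Longrightarrow>
      f (cjoin A B) = cjoin (f A) (f B) \<and> f (cmeet A B) = cmeet (f A) (f B)"
    using assms(1) unfolding lattice_iso_def by blast
  obtain g where g: "bij_betw g M N" "\<And>A B. A \<in> M \<Longrightarrow> B \<in> M \<Longrightarrow>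
      g (cjoin A B) = cjoin (g A) (g B) \<and> g (cmeet A B) = cmeet (g A) (g B)"
    using assms(2) unfolding lattice_iso_def by blast
  have "bij_betw (g \<circ> f) L N"
    by (rule bij_betw_trans[OF f(1) g(1)])
  moreover have "f A \<in> M" if "A \<in> L" for A
    using f(1) that by (auto simp: bij_betw_def)
  ultimately show ?thesis
    unfolding lattice_iso_def using f(2) g(2) by (intro exI[of _ "g \<circ> f"]) simp
qed

lemma equiv_iso_rel: "equiv (gen_lattices n) (iso_rel n)"
proof (rule equivI)
  show "iso_rel n \<subseteq> gen_lattices n \<times> gen_lattices n"
    by (auto simp: iso_rel_def)
  show "refl_on (gen_lattices n) (iso_rel n)"
    by (auto simp: refl_on_def iso_rel_def lattice_iso_refl)
  show "sym (iso_rel n)"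
    by (auto simp: sym_def iso_rel_def gen_lattices_def
        intro: lattice_iso_sym convex_sublattice_gen_lattice)
  show "trans (iso_rel n)"
    by (auto simp: trans_def iso_rel_def intro: lattice_iso_trans)
qed

end

theory Submission
  imports Defs
begin

text \<open>
  At most continuum many classes arise, since a lattice is determined by a finite subset of the
  plane. The work is to produce continuum many.

  Take linearly independent vectors \<open>e\<close>, \<open>d\<close>, the five points \<open>0\<close>, \<open>e\<close>, \<open>2e\<close>, \<open>d\<close>, \<open>2d\<close>
  (a triangle with the midpoints of two of its sides) and further multiples of \<open>e\<close>, and call this
  set of \<open>n - 1\<close> points \<open>F\<close>. Intersections of segments between points already constructed
  yield every point of the segment from \<open>e\<close> to \<open>d\<close> that divides it in a rational ratio: if the
  centre of mass of \<open>e\<close> with weight \<open>a\<close> and \<open>d\<close> with weight \<open>b\<close> has been constructed, two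
  crossings of segments give the centres for the weights \<open>(a + b, b)\<close> and \<open>(a, a + b)\<close>
  (\<open>mass_centre_step\<close>). Reading Euclid's subtractive algorithm backwards, these steps reach all
  pairs of natural weights (\<open>rational_mass_centre_in_gen_lattice\<close>). Hence the members of the
  countable lattice generated by \<open>F\<close> distinguish any two points \<open>p\<close>, \<open>q\<close> of the open segment.

  Now let \<open>p\<close> vary over that segment and consider the lattice generated by \<open>F\<close> together with
  \<open>p\<close>. Whether \<open>p\<close> lies in a set \<open>A\<close> generated by \<open>F\<close> is the lattice equation
  \<open>{p} \<inter> A = {p}\<close>, so \<open>p\<close> is determined by the lattice with its generators marked
  (\<open>same_generator_images_imp_mem\<close>). An isomorphism onto a fixed representative of a class is
  known on the generators once a finite tuple of elements of a countable lattice is known; so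
  each isomorphism class contains the lattices of only countably many \<open>p\<close>
  (\<open>quotient_lepoll_if_separated\<close>). A partition of a set of size continuum into countable blocks
  has continuum many blocks (\<open>lepoll_if_countable_fibres\<close>).
\<close>

section \<open>Generated sublattices\<close>

lemma gen_lattice_induct [consumes 1, case_names singleton join meet]:
  assumes "A \<in> gen_lattice X"
    and "\<And>x. x \<in> X \<Longrightarrow> P {x}"
    and "\<And>A B. A \<in> gen_lattice X \<Longrightarrow> B \<in> gen_lattice X \<Longrightarrow> P A \<Longrightarrow> P B \<Longrightarrow> P (cjoin A B)"
    and "\<And>A B. A \<in> gen_lattice X \<Longrightarrow> B \<in> gen_lattice X \<Longrightarrow> P A \<Longrightarrow> P B \<Longrightarrow> P (cmeet A B)"
  shows "P A"
proof -
  have "gen_lattice X \<subseteq> {A \<in> gen_lattice X. P A}"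
    using convex_sublattice_gen_lattice[of X] assms(2-4)
    by (intro gen_lattice_least) (auto simp: convex_sublattice_def singleton_in_gen_lattice)
  then show ?thesis
    using assms(1) by blast
qed

lemma gen_lattice_mono: "X \<subseteq> Y \<Longrightarrow> gen_lattice X \<subseteq> gen_lattice Y"
  by (intro gen_lattice_least convex_sublattice_gen_lattice) (auto intro: singleton_in_gen_lattice)

lemma gen_lattice_join: "A \<in> gen_lattice X \<Longrightarrow> B \<in> gen_lattice X \<Longrightarrow> cjoin A B \<in> gen_lattice X"
  and gen_lattice_meet: "A \<in> gen_lattice X \<Longrightarrow> B \<in> gen_lattice X \<Longrightarrow> cmeet A B \<in> gen_lattice X"
  using convex_sublattice_gen_lattice[of X] by (auto simp: convex_sublattice_def)

primrec gen_level :: "(real^2) set \<Rightarrow> nat \<Rightarrow> (real^2) set set" where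
  "gen_level X 0 = (\<lambda>x. {x}) ` X"
| "gen_level X (Suc k) = gen_level X k
     \<union> (\<lambda>(A, B). cjoin A B) ` (gen_level X k \<times> gen_level X k)
     \<union> (\<lambda>(A, B). cmeet A B) ` (gen_level X k \<times> gen_level X k)"

lemma gen_level_mono: "i \<le> j \<Longrightarrow> gen_level X i \<subseteq> gen_level X j"
  by (rule lift_Suc_mono_le[of "gen_level X"]) auto

lemma gen_level_join: "A \<in> gen_level X k \<Longrightarrow> B \<in> gen_level X k \<Longrightarrow> cjoin A B \<in> gen_level X (Suc k)"
  and gen_level_meet: "A \<in> gen_level X k \<Longrightarrow> B \<in> gen_level X k \<Longrightarrow> cmeet A B \<in> gen_level X (Suc k)"
  by force+

text \<open>Every element of the lattice appears after finitely many rounds of joins and meets, and each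
  round starting from a countable family stays countable.\<close>

lemma countable_gen_lattice:
  assumes "finite X"
  shows "countable (gen_lattice X)"
proof -
  have "countable (gen_level X k)" for k
    by (induction k) (use assms in \<open>simp_all add: countable_finite\<close>)
  then have "countable (\<Union>k. gen_level X k)"
    by simp
  moreover have "gen_lattice X \<subseteq> (\<Union>k. gen_level X k)"
  proof
    fix A
    assume "A \<in> gen_lattice X"
    then have "\<exists>k. A \<in> gen_level X k"
    proof (induction rule: gen_lattice_induct)
      case (singleton x)
      then show ?case
        by (intro exI[of _ 0]) simp
    next
      case (join A B)
      then obtain i j where "A \<in> gen_level X i" "B \<in> gen_level X j"
        by blast
      then have "A \<in> gen_level X (max i j)" "B \<in> gen_level X (max i j)"
        using gen_level_mono[of i "max i j"] gen_level_mono[of j "max i j"] by auto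
      then show ?case
        using gen_level_join by blast
    next
      case (meet A B)
      then obtain i j where "A \<in> gen_level X i" "B \<in> gen_level X j"
        by blast
      then have "A \<in> gen_level X (max i j)" "B \<in> gen_level X (max i j)"
        using gen_level_mono[of i "max i j"] gen_level_mono[of j "max i j"] by auto
      then show ?case
        using gen_level_meet by blast
    qed
    then show "A \<in> (\<Union>k. gen_level X k)"
      by blast
  qed
  ultimately show ?thesis
    by (rule countable_subset[rotated])
qed

section \<open>Isomorphisms with prescribed values on the generators\<close>

text \<open>The relation \<open>lattice_iso\<close> only asserts that some such map exists; the argument below compares
  the values of chosen maps on generators.\<close>

definition is_lattice_iso :: 
  "((real^2) set \<Rightarrow> (real^2) set) \<Rightarrow> (real^2) set set \<Rightarrow> (real^2) set set \<Rightarrow> bool" where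
  "is_lattice_iso f L M \<longleftrightarrow> bij_betw f L M \<and>
     (\<forall>A\<in>L. \<forall>B\<in>L. f (cjoin A B) = cjoin (f A) (f B) \<and> f (cmeet A B) = cmeet (f A) (f B))"

lemma is_lattice_isos_agree_on_gen_lattice:
  assumes f: "is_lattice_iso f (gen_lattice X) M" and g: "is_lattice_iso g (gen_lattice Y) N"
    and "F \<subseteq> X" "F \<subseteq> Y" and eq: "\<And>x. x \<in> F \<Longrightarrow> f {x} = g {x}"
    and "A \<in> gen_lattice F"
  shows "f A = g A"
  using \<open>A \<in> gen_lattice F\<close>
proof (induction rule: gen_lattice_induct)
  case (singleton x)
  then show ?case by (rule eq)
next
  case (join A B)
  then have "A \<in> gen_lattice X" "B \<in> gen_lattice X" "A \<in> gen_lattice Y" "B \<in> gen_lattice Y"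
    using gen_lattice_mono \<open>F \<subseteq> X\<close> \<open>F \<subseteq> Y\<close> by blast+
  with join f g show ?case
    by (simp add: is_lattice_iso_def)
next
  case (meet A B)
  then have "A \<in> gen_lattice X" "B \<in> gen_lattice X" "A \<in> gen_lattice Y" "B \<in> gen_lattice Y"
    using gen_lattice_mono \<open>F \<subseteq> X\<close> \<open>F \<subseteq> Y\<close> by blast+
  with meet f g show ?case
    by (simp add: is_lattice_iso_def)
qed

text \<open>Membership \<open>p \<in> A\<close> is the equation \<open>{p} \<inter> A = {p}\<close>, which \<open>f\<close> carries to \<open>M\<close> and the inverse
  of \<open>g\<close> carries back to \<open>{q} \<inter> A = {q}\<close>: both maps agree on \<open>A\<close>, because \<open>A\<close> is generated by \<open>F\<close>.\<close>

lemma same_generator_images_imp_mem: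
  assumes f: "is_lattice_iso f (gen_lattice (insert p F)) M"
    and g: "is_lattice_iso g (gen_lattice (insert q F)) M"
    and eq: "\<And>x. x \<in> F \<Longrightarrow> f {x} = g {x}" and pq: "f {p} = g {q}"
    and A: "A \<in> gen_lattice F" and "p \<in> A"
  shows "q \<in> A"
proof -
  have p: "{p} \<in> gen_lattice (insert p F)" and q: "{q} \<in> gen_lattice (insert q F)"
    by (auto intro: singleton_in_gen_lattice)
  have Ap: "A \<in> gen_lattice (insert p F)" and Aq: "A \<in> gen_lattice (insert q F)"
    using A gen_lattice_mono[of F] by blast+
  have fg: "f A = g A"
    by (rule is_lattice_isos_agree_on_gen_lattice[OF f g _ _ eq A]) auto
  have "cmeet {p} A = {p}"
    using \<open>p \<in> A\<close> by (simp add: cmeet_def)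
  then have "cmeet (f {p}) (f A) = f {p}"
    using f p Ap by (metis is_lattice_iso_def)
  then have "g (cmeet {q} A) = g {q}"
    using g q Aq fg pq by (simp add: is_lattice_iso_def)
  then have "cmeet {q} A = {q}"
    using g q gen_lattice_meet[OF q Aq] by (meson bij_betw_def inj_onD is_lattice_iso_def)
  then show ?thesis
    by (auto simp: cmeet_def)
qed

section \<open>Cardinalities\<close>

text \<open>The image is infinite, as a finite union of countable fibres would be countable. So every fibre
  is at most as large as the image, and a union of \<open>\<kappa>\<close> many sets of size at most an infinite \<open>\<kappa>\<close>
  has size at most \<open>\<kappa>\<close>.\<close>

lemma lepoll_if_countable_fibres:
  assumes unc: "uncountable S" and fib: "\<And>y. y \<in> \<Phi> ` S \<Longrightarrow> countable {x \<in> S. \<Phi> x = y}"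
  shows "S \<lesssim> \<Phi> ` S"
proof -
  let ?A = "\<lambda>y. {x \<in> S. \<Phi> x = y}"
  have S: "S = (\<Union>y\<in>\<Phi> ` S. ?A y)"
    by blast
  have inf: "infinite (\<Phi> ` S)"
  proof
    assume "finite (\<Phi> ` S)"
    then have "countable (\<Union>y\<in>\<Phi> ` S. ?A y)"
      using fib by (intro countable_UN) (auto simp: countable_finite)
    with unc S show False
      by simp
  qed
  have "(card_of (?A y), card_of (\<Phi> ` S)) \<in> ordLeq" if "y \<in> \<Phi> ` S" for y
  proof -
    have "(card_of (?A y), card_of (UNIV :: nat set)) \<in> ordLeq"
      using fib[OF that] unfolding countable_def card_of_ordLeq[symmetric] by auto
    moreover have "(card_of (UNIV :: nat set), card_of (\<Phi> ` S)) \<in> ordLeq"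
      using inf by (simp add: infinite_iff_card_of_nat)
    ultimately show ?thesis
      by (rule ordLeq_transitive)
  qed
  then have "(card_of (\<Union>y\<in>\<Phi> ` S. ?A y), card_of (\<Phi> ` S)) \<in> ordLeq"
    by (intro card_of_UNION_ordLeq_infinite[OF inf]) (auto simp: card_of_refl ordIso_imp_ordLeq)
  then show ?thesis
    unfolding S[symmetric] lepoll_def by (simp add: card_of_ordLeq)
qed

lemma sets_of_card_lepoll:
  assumes inf: "infinite (UNIV :: 'a set)"
  shows "{X :: 'a set. finite X \<and> card X = n} \<lesssim> (UNIV :: 'a set)"
proof (induction n)
  case 0
  have "{X :: 'a set. finite X \<and> card X = 0} = {{}}"
    by auto
  then show ?case
    by (simp add: lepoll_def)
next
  case (Suc n)
  let ?S = "{X :: 'a set. finite X \<and> card X = n}"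
  have "{X :: 'a set. finite X \<and> card X = Suc n} \<subseteq> (\<lambda>(x, X). insert x X) ` (UNIV \<times> ?S)"
    by (force simp: card_Suc_eq)
  then have "{X :: 'a set. finite X \<and> card X = Suc n} \<lesssim> (UNIV :: 'a set) \<times> ?S"
    by (rule subset_image_lepoll)
  also have "\<dots> \<lesssim> (UNIV :: 'a set) \<times> (UNIV :: 'a set)"
    by (intro times_lepoll_mono Suc.IH lepoll_refl)
  also have "\<dots> \<lesssim> (UNIV :: 'a set)"
    using card_of_Times_same_infinite[OF inf]
    by (simp add: eqpoll_iff_card_of_ordIso eqpoll_imp_lepoll)
  finally show ?case .
qed

lemma plane_lepoll_reals: "(UNIV :: (real^2) set) \<lesssim> (UNIV :: real set)"
proof -
  have "inj (\<lambda>x :: real^2. (x $ 1, x $ 2))"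
    by (auto simp: inj_def vec_eq_iff forall_2)
  then have "(UNIV :: (real^2) set) \<lesssim> (UNIV :: real set) \<times> (UNIV :: real set)"
    by (auto simp: lepoll_def)
  also have "\<dots> \<lesssim> (UNIV :: real set)"
    using card_of_Times_same_infinite[of "UNIV :: real set"]
    by (simp add: infinite_UNIV_char_0 eqpoll_iff_card_of_ordIso eqpoll_imp_lepoll)
  finally show ?thesis .
qed

lemma gen_lattices_quotient_lepoll_reals:
  "gen_lattices n // iso_rel n \<lesssim> (UNIV :: real set)"
proof -
  have "gen_lattices n // iso_rel n = (\<lambda>L. iso_rel n `` {L}) ` gen_lattices n"
    by (auto simp: quotient_def)
  then have "gen_lattices n // iso_rel n \<lesssim> gen_lattices n"
    by (simp add: image_lepoll)
  also have "gen_lattices n \<lesssim> {X :: (real^2) set. finite X \<and> card X = n}"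
    by (rule subset_image_lepoll[of _ gen_lattice]) (auto simp: gen_lattices_def)
  also have "\<dots> \<lesssim> (UNIV :: (real^2) set)"
    by (intro sets_of_card_lepoll infinite_UNIV_char_0)
  also note plane_lepoll_reals
  finally show ?thesis .
qed

text \<open>The free generator \<open>p\<close> can be recovered, within one isomorphism class, from the images of the
  generators under an isomorphism onto a representative \<open>K r\<close> of the class. Those images form a
  finite tuple in a countable set. Isomorphisms may permute generators or send them to other
  elements, which is why fibres are only shown to be countable.\<close>

lemma quotient_lepoll_if_separated:
  assumes F: "finite F" and unc: "uncountable P" and disj: "P \<inter> F = {}"
    and sep: "\<And>p q. p \<in> P \<Longrightarrow> q \<in> P \<Longrightarrow> (\<And>A. A \<in> gen_lattice F \<Longrightarrow> p \<in> A \<longleftrightarrow> q \<in> A) \<Longrightarrow> p = q"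
    and n: "n = Suc (card F)"
  shows "P \<lesssim> gen_lattices n // iso_rel n"
proof -
  define K where "K p = gen_lattice (insert p F)" for p
  define \<Phi> where "\<Phi> p = iso_rel n `` {K p}" for p
  have K: "K p \<in> gen_lattices n" if "p \<in> P" for p
    using that disj F n by (force simp: K_def gen_lattices_def)
  have "countable {p \<in> P. \<Phi> p = y}" if y: "y \<in> \<Phi> ` P" for y
  proof -
    obtain r where r: "r \<in> P" "y = \<Phi> r"
      using y by blast
    have "\<exists>f. is_lattice_iso f (K p) (K r)" if "p \<in> P" "\<Phi> p = y" for p
      using eq_equiv_class[OF _ equiv_iso_rel K[OF r(1)], of "K p"] that r
      by (auto simp: \<Phi>_def iso_rel_def lattice_iso_def is_lattice_iso_def)
    then obtain f where f: "\<And>p. p \<in> P \<Longrightarrow> \<Phi> p = y \<Longrightarrow> is_lattice_iso (f p) (K p) (K r)"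
      by metis
    \<comment> \<open>Functions restricted to \<open>F\<close> are extensional, so that the codes lie in a countable set.\<close>
    define code where "code p = (f p {p}, \<lambda>x\<in>F. f p {x})" for p
    have "inj_on code {p \<in> P. \<Phi> p = y}"
    proof (rule inj_onI)
      fix p q
      assume p: "p \<in> {p \<in> P. \<Phi> p = y}" and q: "q \<in> {p \<in> P. \<Phi> p = y}" and "code p = code q"
      then have pq: "f p {p} = f q {q}" and "restrict (\<lambda>x. f p {x}) F = restrict (\<lambda>x. f q {x}) F"
        by (auto simp: code_def)
      then have eq: "f p {x} = f q {x}" if "x \<in> F" for x
        using that by (auto dest!: fun_cong[where x = x])
      have isos: "is_lattice_iso (f p) (gen_lattice (insert p F)) (K r)"
        "is_lattice_iso (f q) (gen_lattice (insert q F)) (K r)"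
        using f p q by (auto simp: K_def)
      show "p = q"
        using p q same_generator_images_imp_mem[OF isos eq pq]
          same_generator_images_imp_mem[OF isos(2,1) eq[symmetric] pq[symmetric]]
        by (intro sep) auto
    qed
    moreover have "code ` {p \<in> P. \<Phi> p = y} \<subseteq> K r \<times> (F \<rightarrow>\<^sub>E K r)"
    proof -
      have "f p {x} \<in> K r" if "p \<in> P" "\<Phi> p = y" "x \<in> insert p F" for p x
        using f[OF that(1,2)] singleton_in_gen_lattice[OF that(3)]
        by (auto simp: is_lattice_iso_def K_def bij_betw_def)
      then show ?thesis
        by (auto simp: code_def)
    qed
    moreover have "countable (K r \<times> (F \<rightarrow>\<^sub>E K r))"
      using F by (intro countable_SIGMA countable_PiE) (auto simp: K_def countable_gen_lattice)
    ultimately show ?thesis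
      by (meson countable_image_inj_on countable_subset)
  qed
  then have "P \<lesssim> \<Phi> ` P"
    by (rule lepoll_if_countable_fibres[OF unc])
  also have "\<dots> \<lesssim> gen_lattices n // iso_rel n"
    using K by (intro subset_imp_lepoll) (auto simp: \<Phi>_def quotient_def)
  finally show ?thesis .
qed

section \<open>Constructing points with segments\<close>

lemma cjoin_singletons: "cjoin {a} {b} = closed_segment a b"
  by (simp add: cjoin_def segment_convex_hull insert_commute)

text \<open>The determinant of two plane vectors; it vanishes exactly for parallel ones.\<close>

definition cross2 :: "real^2 \<Rightarrow> real^2 \<Rightarrow> real" where
  "cross2 a b = a $ 1 * b $ 2 - a $ 2 * b $ 1"

text \<open>Two points common to both segments would differ by a vector parallel to both, so non-parallel
  segments meet in a single point, which is then a meet of two joins of singletons.\<close>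

lemma crossing_in_gen_lattice:
  assumes abcd: "{a} \<in> gen_lattice X" "{b} \<in> gen_lattice X" "{c} \<in> gen_lattice X" "{d} \<in> gen_lattice X"
    and z: "z \<in> closed_segment a b" "z \<in> closed_segment c d"
    and cross: "cross2 (b - a) (d - c) \<noteq> 0"
  shows "{z} \<in> gen_lattice X"
proof -
  have unique: "y = z" if y: "y \<in> closed_segment a b" "y \<in> closed_segment c d" for y
  proof -
    obtain s s' where yz: "y = (1 - s) *\<^sub>R a + s *\<^sub>R b" "z = (1 - s') *\<^sub>R a + s' *\<^sub>R b"
      using y z by (auto simp: in_segment)
    then have s: "y - z = (s - s') *\<^sub>R (b - a)"
      unfolding yz by (simp add: algebra_simps)
    obtain r r' where yz': "y = (1 - r) *\<^sub>R c + r *\<^sub>R d" "z = (1 - r') *\<^sub>R c + r' *\<^sub>R d"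
      using y z by (auto simp: in_segment)
    then have r: "y - z = (r - r') *\<^sub>R (d - c)"
      unfolding yz' by (simp add: algebra_simps)
    have "(s - s') * cross2 (b - a) (d - c) = cross2 (y - z) (d - c)"
      unfolding s by (simp add: cross2_def algebra_simps)
    also have "\<dots> = 0"
      unfolding r by (simp add: cross2_def)
    finally have "s = s'"
      using cross by simp
    with s show ?thesis
      by simp
  qed
  have "closed_segment a b \<inter> closed_segment c d = {z}"
    using z by (intro equalityI subsetI) (simp_all add: unique)
  then have "{z} = cmeet (cjoin {a} {b}) (cjoin {c} {d})"
    by (simp add: cmeet_def cjoin_singletons)
  then show ?thesis
    using abcd by (simp add: gen_lattice_join gen_lattice_meet)
qed

definition mass_centre :: "real^2 \<Rightarrow> real^2 \<Rightarrow> real \<Rightarrow> real \<Rightarrow> real^2" where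
  "mass_centre e d a b = (a / (a + b)) *\<^sub>R e + (b / (a + b)) *\<^sub>R d"

lemma cross2_combination:
  "cross2 (x *\<^sub>R e + y *\<^sub>R d) (u *\<^sub>R e + v *\<^sub>R d) = (x * v - y * u) * cross2 e d"
  by (simp add: cross2_def algebra_simps)

text \<open>Write \<open>P\<close> for the centre with weights \<open>(a, b)\<close>. The segment from \<open>2e\<close> to \<open>P\<close> crosses the
  segment from \<open>e\<close> to \<open>2d\<close> in a point \<open>R\<close>, and the segment from \<open>0\<close> to \<open>R\<close> crosses the segment
  from \<open>e\<close> to \<open>d\<close> in a point \<open>Q\<close>. In the coordinate \<open>w = b / (a + b)\<close> along that last segment,
  passing from \<open>P\<close> to \<open>Q\<close> is the map \<open>w \<mapsto> w / (1 + w)\<close> that underlies the Farey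
  sequence.\<close>

lemma mass_centre_step:
  assumes gens: "{0} \<in> gen_lattice X" "{e} \<in> gen_lattice X" "{2 *\<^sub>R e} \<in> gen_lattice X"
      "{d} \<in> gen_lattice X" "{2 *\<^sub>R d} \<in> gen_lattice X"
    and indep: "cross2 e d \<noteq> 0" and ab: "0 \<le> a" "0 \<le> b" "0 < a + b"
    and P: "{mass_centre e d a b} \<in> gen_lattice X"
  shows "{mass_centre e d (a + b) b} \<in> gen_lattice X"
proof -
  \<comment> \<open>The denominators of the barycentric coordinates of \<open>P\<close>, \<open>Q\<close> and \<open>R\<close>.\<close>
  define k where "k = a + b"
  define l where "l = k + b"
  define m where "m = 2 * k + b"
  have pos: "0 < k" "0 < l" "0 < m"
    using ab by (auto simp: k_def l_def m_def)
  define P where "P = (a / k) *\<^sub>R e + (b / k) *\<^sub>R d"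
  define R where "R = (2 * k / m) *\<^sub>R e + (2 * b / m) *\<^sub>R d"
  define Q where "Q = (k / l) *\<^sub>R e + (b / l) *\<^sub>R d"
  have "{R} \<in> gen_lattice X"
  proof (rule crossing_in_gen_lattice[of e X "2 *\<^sub>R d" "2 *\<^sub>R e" P])
    have "1 - b / m = 2 * k / m"
      using pos by (simp add: m_def field_simps)
    then have "R = (1 - b / m) *\<^sub>R e + (b / m) *\<^sub>R (2 *\<^sub>R d)"
      by (simp add: R_def)
    moreover have "0 \<le> b / m" "b / m \<le> 1"
      using ab pos by (simp_all add: m_def)
    ultimately show "R \<in> closed_segment e (2 *\<^sub>R d)"
      unfolding in_segment by blast
  next
    have "(1 - 2 * k / m) * 2 = 2 * b / m"
      using pos by (simp add: m_def field_simps)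
    moreover have "(2 * k / m) * (a / k) = 2 * a / m"
      using pos by simp
    ultimately have "(1 - 2 * k / m) * 2 + (2 * k / m) * (a / k) = 2 * k / m"
      by (simp add: k_def add_divide_distrib)
    moreover have "(2 * k / m) * (b / k) = 2 * b / m"
      using pos by simp
    ultimately have "R = ((1 - 2 * k / m) * 2 + (2 * k / m) * (a / k)) *\<^sub>R e
        + ((2 * k / m) * (b / k)) *\<^sub>R d"
      by (simp only: R_def)
    then have "R = (1 - 2 * k / m) *\<^sub>R (2 *\<^sub>R e) + (2 * k / m) *\<^sub>R P"
      by (simp only: P_def scaleR_add_right scaleR_scaleR scaleR_add_left add.assoc)
    moreover have "0 \<le> 2 * k / m" "2 * k / m \<le> 1"
      using ab pos by (simp_all add: m_def)
    ultimately show "R \<in> closed_segment (2 *\<^sub>R e) P"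
      unfolding in_segment by blast
  next
    have "cross2 (2 *\<^sub>R d - e) (P - 2 *\<^sub>R e)
        = cross2 ((- 1) *\<^sub>R e + 2 *\<^sub>R d) ((a / k - 2) *\<^sub>R e + (b / k) *\<^sub>R d)"
      by (simp add: P_def algebra_simps)
    also have "\<dots> = (- 1 * (b / k) - 2 * (a / k - 2)) * cross2 e d"
      by (rule cross2_combination)
    also have "- 1 * (b / k) - 2 * (a / k - 2) = m / k"
    proof -
      have ak: "a / k = 1 - b / k"
        using pos by (simp add: k_def field_simps)
      have mk: "m / k = 2 + b / k"
        using pos by (simp add: m_def add_divide_distrib)
      have "- 1 * y - 2 * (1 - y - 2) = 2 + y" for y :: real
        by simp
      then show ?thesis
        unfolding ak mk .
    qed
    finally show "cross2 (2 *\<^sub>R d - e) (P - 2 *\<^sub>R e) \<noteq> 0"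
      using indep pos by simp
  qed (use gens P in \<open>simp_all add: P_def mass_centre_def k_def\<close>)
  then have "{Q} \<in> gen_lattice X"
  proof (rule crossing_in_gen_lattice[of 0 X R e d, OF gens(1) _ gens(2,4)])
    have "Q = (1 - m / (2 * l)) *\<^sub>R 0 + (m / (2 * l)) *\<^sub>R R"
      using pos by (simp add: Q_def R_def scaleR_add_right)
    moreover have "0 \<le> m / (2 * l)" "m / (2 * l) \<le> 1"
      using ab pos by (simp_all add: m_def l_def)
    ultimately show "Q \<in> closed_segment 0 R"
      unfolding in_segment by blast
  next
    have "1 - b / l = k / l"
      using pos by (simp add: l_def field_simps)
    then have "Q = (1 - b / l) *\<^sub>R e + (b / l) *\<^sub>R d"
      by (simp add: Q_def)
    moreover have "0 \<le> b / l" "b / l \<le> 1"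
      using ab pos by (simp_all add: l_def)
    ultimately show "Q \<in> closed_segment e d"
      unfolding in_segment by blast
  next
    have "cross2 (R - 0) (d - e) = cross2 R ((- 1) *\<^sub>R e + 1 *\<^sub>R d)"
      by simp
    also have "\<dots> = (2 * k / m * 1 - 2 * b / m * - 1) * cross2 e d"
      unfolding R_def by (rule cross2_combination)
    also have "2 * k / m * 1 - 2 * b / m * - 1 = 2 * l / m"
      by (simp add: l_def add_divide_distrib distrib_left)
    finally show "cross2 (R - 0) (d - e) \<noteq> 0"
      using indep pos by simp
  qed
  then show ?thesis
    by (simp add: Q_def mass_centre_def k_def l_def)
qed

lemma mass_centre_swap: "mass_centre d e b a = mass_centre e d a b"
  by (simp add: mass_centre_def add.commute)

lemma cross2_swap: "cross2 d e = - cross2 e d"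
  by (simp add: cross2_def algebra_simps)

text \<open>Euclid's subtractive algorithm: subtracting the smaller weight from the larger one undoes a step
  of \<open>mass_centre_step\<close>, applied to \<open>(e, d)\<close> or to \<open>(d, e)\<close>, until one weight is zero and the centre
  is one of the generators \<open>e\<close>, \<open>d\<close>.\<close>

lemma rational_mass_centre_in_gen_lattice:
  assumes gens: "{0} \<in> gen_lattice X" "{e} \<in> gen_lattice X" "{2 *\<^sub>R e} \<in> gen_lattice X"
      "{d} \<in> gen_lattice X" "{2 *\<^sub>R d} \<in> gen_lattice X"
    and indep: "cross2 e d \<noteq> 0" and "0 < a + b"
  shows "{mass_centre e d (real a) (real b)} \<in> gen_lattice X"
  using \<open>0 < a + b\<close>
proof (induction "a + b" arbitrary: a b rule: less_induct)
  case less
  consider "b = 0" | "a = 0" | "0 < a" "0 < b" "b \<le> a" | "0 < a" "0 < b" "a \<le> b"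
    by linarith
  then show ?case
  proof cases
    case 1
    with less.prems gens(2) show ?thesis
      by (simp add: mass_centre_def)
  next
    case 2
    with less.prems gens(4) show ?thesis
      by (simp add: mass_centre_def)
  next
    case 3
    then have "{mass_centre e d (real (a - b)) (real b)} \<in> gen_lattice X"
      by (intro less.hyps) auto
    from mass_centre_step[OF gens indep _ _ _ this] 3 show ?thesis
      by simp
  next
    case 4
    then have "{mass_centre e d (real a) (real (b - a))} \<in> gen_lattice X"
      by (intro less.hyps) auto
    then have "{mass_centre d e (real (b - a)) (real a)} \<in> gen_lattice X"
      by (simp add: mass_centre_swap)
    from mass_centre_step[OF gens(1,4,5,2,3) _ _ _ _ this] 4 indep show ?thesis
      by (simp add: cross2_swap[of d e] mass_centre_swap[of d e])
  qed
qed

text \<open>The segment from \<open>e\<close> to a rational point strictly between the two given points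
  contains one of them and not the other.\<close>

lemma separating_element:
  assumes gens: "{0} \<in> gen_lattice X" "{e} \<in> gen_lattice X" "{2 *\<^sub>R e} \<in> gen_lattice X"
      "{d} \<in> gen_lattice X" "{2 *\<^sub>R d} \<in> gen_lattice X"
    and indep: "cross2 e d \<noteq> 0" and st: "0 < s" "s < t" "t < 1"
  shows "\<exists>A \<in> gen_lattice X. (1 - s) *\<^sub>R e + s *\<^sub>R d \<in> A \<and> (1 - t) *\<^sub>R e + t *\<^sub>R d \<notin> A"
proof -
  obtain r where r: "r \<in> \<rat>" "s < r" "r < t"
    using Rats_dense_in_real[OF \<open>s < t\<close>] by blast
  obtain b m :: nat where m: "m \<noteq> 0" "r = real b / real m"
    using Rats_abs_nat_div_natE[OF r(1)] r st by (metis abs_of_pos less_trans)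
  then have "real b = r * real m" "0 < real m"
    by auto
  then have "real b < real m"
    using r st by simp
  define q where "q = mass_centre e d (real (m - b)) (real b)"
  have q: "q = (1 - r) *\<^sub>R e + r *\<^sub>R d"
    using \<open>real b < real m\<close> m
    by (simp add: q_def mass_centre_def of_nat_diff diff_divide_distrib)
  let ?A = "cjoin {e} {q}"
  have "{q} \<in> gen_lattice X"
    unfolding q_def using \<open>real b < real m\<close>
    by (intro rational_mass_centre_in_gen_lattice gens indep) auto
  then have "?A \<in> gen_lattice X"
    by (intro gen_lattice_join gens)
  moreover have "(1 - s) *\<^sub>R e + s *\<^sub>R d \<in> ?A"
    unfolding cjoin_singletons in_segment
    using r st by (intro exI[of _ "s / r"]) (auto simp: q vec_eq_iff field_simps)
  moreover have "(1 - t) *\<^sub>R e + t *\<^sub>R d \<notin> ?A"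
  proof
    assume "(1 - t) *\<^sub>R e + t *\<^sub>R d \<in> ?A"
    then obtain u where u: "u \<le> 1" "(1 - t) *\<^sub>R e + t *\<^sub>R d = (1 - u) *\<^sub>R e + u *\<^sub>R q"
      unfolding cjoin_singletons in_segment by blast
    \<comment> \<open>The determinant with \<open>e\<close> reads off the coordinate along \<open>d\<close>.\<close>
    have "t * cross2 e d = cross2 e ((1 - t) *\<^sub>R e + t *\<^sub>R d)"
      by (simp add: cross2_def algebra_simps)
    also have "\<dots> = u * r * cross2 e d"
      unfolding u q by (simp add: cross2_def algebra_simps)
    finally have "t = u * r"
      using indep by simp
    moreover have "u * r \<le> 1 * r"
      using u(1) r st by (intro mult_right_mono) auto
    ultimately show False
      using r by simp
  qed
  ultimately show ?thesis
    by blast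
qed

theorem theorem10:
  fixes n :: nat
  assumes "n \<ge> 6"
  shows "gen_lattices n // iso_rel n \<approx> (UNIV :: real set)"
proof (rule lepoll_antisym)
  show "gen_lattices n // iso_rel n \<lesssim> (UNIV :: real set)"
    by (rule gen_lattices_quotient_lepoll_reals)
next
  define e d :: "real^2" where "e = vector [1, 0]" and "d = vector [0, 1]"
  have indep: "cross2 e d \<noteq> 0"
    by (simp add: cross2_def e_def d_def)
  \<comment> \<open>The multiples \<open>0\<close>, \<open>e\<close>, \<open>2e\<close> are used in the construction; the others fill up the cardinality
    and stay off the open segment from \<open>e\<close> to \<open>d\<close>.\<close>
  define F where "F = {d, 2 *\<^sub>R d} \<union> (\<lambda>k. real k *\<^sub>R e) ` {..<n - 3}"
  have F: "finite F"
    by (simp add: F_def)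
  have "inj (\<lambda>k. real k *\<^sub>R e)"
    by (auto simp: inj_def e_def vec_eq_iff forall_2)
  then have "card ((\<lambda>k. real k *\<^sub>R e) ` {..<n - 3}) = n - 3"
    by (simp add: card_image inj_on_subset)
  moreover have "card {d, 2 *\<^sub>R d} = 2"
    by (simp add: d_def vec_eq_iff forall_2)
  moreover have "{d, 2 *\<^sub>R d} \<inter> (\<lambda>k. real k *\<^sub>R e) ` {..<n - 3} = {}"
    by (auto simp: d_def e_def vec_eq_iff forall_2)
  ultimately have n: "n = Suc (card F)"
    using assms unfolding F_def by (subst card_Un_disjoint) auto
  define pt where "pt t = (1 - t) *\<^sub>R e + t *\<^sub>R d" for t
  have "real k *\<^sub>R e \<in> F" if "k < 3" for k
    unfolding F_def using that assms by (intro UnI2 imageI) simp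
  from this[of 0] this[of 1] this[of 2] have "0 \<in> F" "e \<in> F" "2 *\<^sub>R e \<in> F" "d \<in> F" "2 *\<^sub>R d \<in> F"
    by (simp_all add: F_def)
  then have gens: "{0} \<in> gen_lattice F" "{e} \<in> gen_lattice F" "{2 *\<^sub>R e} \<in> gen_lattice F"
      "{d} \<in> gen_lattice F" "{2 *\<^sub>R d} \<in> gen_lattice F"
    by (simp_all add: singleton_in_gen_lattice)
  have inj: "inj_on pt {0<..<1}"
    by (auto simp: inj_on_def pt_def e_def d_def vec_eq_iff forall_2)
  have "(UNIV :: real set) \<lesssim> {0<..<1::real}"
    by (simp add: open_interval_eqpoll_reals eqpoll_sym eqpoll_imp_lepoll)
  also have "\<dots> \<lesssim> pt ` {0<..<1}"
    using inj by simp
  also have "\<dots> \<lesssim> gen_lattices n // iso_rel n"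
  proof (rule quotient_lepoll_if_separated[OF F _ _ _ n])
    show "uncountable (pt ` {0<..<1})"
      using countable_image_inj_on[OF _ inj] uncountable_open_interval[of 0 "1::real"] by auto
    show "pt ` {0<..<1} \<inter> F = {}"
      by (auto simp: F_def pt_def e_def d_def vec_eq_iff forall_2)
  next
    fix p q
    assume "p \<in> pt ` {0<..<1}" "q \<in> pt ` {0<..<1}"
      and same: "\<And>A. A \<in> gen_lattice F \<Longrightarrow> p \<in> A \<longleftrightarrow> q \<in> A"
    then obtain s t where st: "p = pt s" "q = pt t" "0 < s" "s < 1" "0 < t" "t < 1"
      by auto
    then show "p = q"
      using separating_element[OF gens indep, of s t] separating_element[OF gens indep, of t s] same
      by (cases s t rule: linorder_cases) (auto simp: pt_def)
  qed
  finally show "(UNIV :: real set) \<lesssim> gen_lattices n // iso_rel n" .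
qed

end
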